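(* Let $c(n)$ denote the number of length-$n$ factors of the Thue-Morse word $\mathbf{t}$, counted up to cyclic rotation. Then $\limsup_{n \rightarrow \infty} c(n)/n = 2$.
   Context: The Thue-Morse word is the infinite binary word $\mathbf{t} = t_0 t_1 t_2 \cdots = 01101001\cdots$, where $t_m$ is the parity of the number of $1$s in the binary representation of $m$. A length-$n$ factor of $\mathbf{t}$ is a word of the form $t_i t_{i+1} \cdots t_{i+n-1}$ for some $i \geq 0$. Two words $x,y$ are cyclically equivalent (equal up to cyclic rotation) if there are words $u,v$ (possibly empty) with $x = uv$ and $y = vu$. For $n \ge 0$, $c(n)$ is the number of cyclic-equivalence classes of words that contain at least one length-$n$ factor of $\mathbf{t}$; i.e., factors of length $n$ that are the same up to cyclic shift are counted once (so $c(0)=1$, $c(1)=2$, $c(2)=3$, $c(3)=2$, $c(4)=4$). *)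

theory Defs
  imports Complex_Main "HOL-Library.Extended_Real"
begin

definition thue_morse :: "nat \<Rightarrow> nat" where
  "thue_morse m = card {k. bit m k} mod 2"

definition tm_factors :: "nat \<Rightarrow> nat list set" where
  "tm_factors n = {w. \<exists>i. w = map thue_morse [i..<i + n]}"

definition cyc_equiv :: "('a list \<times> 'a list) set" where
  "cyc_equiv = {(x, y). \<exists>u v. x = u @ v \<and> y = v @ u}"

(* A cyclic-equivalence class may contain words that are not factors; only one
   of its members has to be a factor for the class to be counted. *)
definition cyc_complexity :: "nat \<Rightarrow> nat" where
  "cyc_complexity n = card {C \<in> UNIV // cyc_equiv. \<exists>w \<in> tm_factors n. w \<in> C}"

lemma equiv_cyc_equiv: "equiv UNIV (cyc_equiv :: ('a list \<times> 'a list) set)" (is "equiv _ ?R")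
proof (rule equivI)
  show "refl ?R"
    by (auto simp: refl_on_def cyc_equiv_def)
  show "sym ?R"
    by (auto simp: sym_def cyc_equiv_def)
  show "trans ?R"
  proof (rule transI)
    have rot: "(x, y) \<in> cyc_equiv \<longleftrightarrow> (\<exists>n. y = rotate n x)" for x y :: "'a list"
    proof
      assume "(x, y) \<in> cyc_equiv"
      then show "\<exists>n. y = rotate n x"
        unfolding cyc_equiv_def by (auto intro: rotate_append[symmetric])
    next
      assume "\<exists>n. y = rotate n x"
      then obtain n where "y = drop (n mod length x) x @ take (n mod length x) x"
        by (auto simp: rotate_drop_take)
      moreover have "x = take (n mod length x) x @ drop (n mod length x) x"
        by simp
      ultimately show "(x, y) \<in> cyc_equiv"
        unfolding cyc_equiv_def by blast
    qed
    show "(x, z) \<in> cyc_equiv" if "(x, y) \<in> cyc_equiv" "(y, z) \<in> cyc_equiv"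
      for x y z :: "'a list"
      using that unfolding rot by (auto simp: rotate_rotate intro: exI)
  qed
qed simp

lemma finite_tm_factors: "finite (tm_factors n)"
proof (rule finite_subset)
  show "tm_factors n \<subseteq> {w. set w \<subseteq> {0, 1} \<and> length w = n}"
    by (auto simp: tm_factors_def thue_morse_def)
qed (simp add: finite_lists_length_eq)

end

theory Submission
  imports Defs
begin

text \<open>
  Let $d(n)$ and $e(n)$ be the numbers of factors of length $n + 1$ whose first and last letters
  differ and agree, respectively. Sliding a window of length $n$ along the word by one position
  rotates its content unless the letter that leaves differs from the one that enters. As the word
  is not ultimately periodic, this eventually happens from any starting position, so every
  cyclic class can be charged to one of the $d(n)$ words and $c(n) \<le> d(n)$. Desubstitution by
  the Thue-Morse morphism gives $d(2m) \<le> 2d(m)$ and $d(2m+1) \<le> e(m) + e(m+1)$, and likewise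
  with $d$ and $e$ exchanged, whence $d(n), e(n) \<le> 2n$.

  For the lower bound, factors of length $2m$ that start at an even position contribute $c(m)$
  classes, while those that start at an odd position and have equal first and last letters lie
  in $d(m)$ further, pairwise distinct classes. Hence $c(2m) \<ge> c(m) + d(m)$ for
  large $m$, and with $d(2m) = 2d(m)$ this yields $c(2^k) \<ge> 2 \<cdot> 2^k - O(1)$.
\<close>

section \<open>Recursion and local structure of the Thue-Morse word\<close>

lemma finite_bits: "finite {k. bit (m :: nat) k}"
proof (rule finite_subset)
  show "{k. bit m k} \<subseteq> {..m}"
  proof safe
    fix k assume "bit m k"
    then have "odd (m div 2 ^ k)" by (simp add: bit_iff_odd)
    then have "m div 2 ^ k \<noteq> 0" by (intro notI) simp
    then have "2 ^ k \<le> m" by (simp add: div_eq_0_iff)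
    moreover have "k < 2 ^ k" by (rule less_exp)
    ultimately show "k \<le> m" by (metis le_trans less_imp_le)
  qed
qed simp

lemma thue_morse_double: "thue_morse (2 * m) = thue_morse m"
proof -
  have "{k. bit (2 * m) k} = Suc ` {k. bit m k}"
  proof (rule set_eqI)
    show "k \<in> {k. bit (2 * m) k} \<longleftrightarrow> k \<in> Suc ` {k. bit m k}" for k
      by (cases k) (auto simp: bit_Suc bit_0)
  qed
  then show ?thesis by (simp add: thue_morse_def card_image)
qed

lemma thue_morse_less: "thue_morse m < 2"
  by (simp add: thue_morse_def)

lemma thue_morse_Suc_double: "thue_morse (Suc (2 * m)) = 1 - thue_morse m"
proof -
  have "{k. bit (Suc (2 * m)) k} = insert 0 (Suc ` {k. bit m k})"
  proof (rule set_eqI)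
    show "k \<in> {k. bit (Suc (2 * m)) k} \<longleftrightarrow> k \<in> insert 0 (Suc ` {k. bit m k})" for k
      by (cases k) (auto simp: bit_Suc bit_0)
  qed
  then have "card {k. bit (Suc (2 * m)) k} = Suc (card {k. bit m k})"
    by (simp add: card_image finite_bits)
  then show ?thesis unfolding thue_morse_def by presburger
qed

lemma thue_morse_0: "thue_morse 0 = 0"
  by (simp add: thue_morse_def)

lemma thue_morse_eq_iff_double:
  "thue_morse (Suc (2 * i)) = thue_morse (Suc (2 * j)) \<longleftrightarrow> thue_morse i = thue_morse j"
  "thue_morse (2 * i) = thue_morse (Suc (2 * j)) \<longleftrightarrow> thue_morse i \<noteq> thue_morse j"
  "thue_morse (Suc (2 * i)) = thue_morse (2 * j) \<longleftrightarrow> thue_morse i \<noteq> thue_morse j"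
  using thue_morse_less[of i] thue_morse_less[of j]
  unfolding thue_morse_double thue_morse_Suc_double by arith+

lemma thue_morse_Suc_neq: "even i \<Longrightarrow> thue_morse (Suc i) \<noteq> thue_morse i"
  by (elim evenE) (simp add: thue_morse_eq_iff_double)

text \<open>One of the two adjacent pairs starts at an even position and is therefore a block
  \<open>[a, 1 - a]\<close>.\<close>

lemma thue_morse_no_cube:
  "\<not> (thue_morse i = thue_morse (Suc i) \<and> thue_morse (Suc i) = thue_morse (Suc (Suc i)))"
  using thue_morse_Suc_neq[of i] thue_morse_Suc_neq[of "Suc i"] by (cases "even i") auto

text \<open>Five alternating letters agree at \<open>i\<close>, \<open>i + 2\<close> and
  \<open>i + 4\<close>, positions of one parity. Halving these positions would give three equal
  consecutive letters.\<close>

lemma thue_morse_not_alternating: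
  "\<exists>q<4. thue_morse (i + q) = thue_morse (Suc (i + q))"
proof (rule ccontr)
  assume "\<not> ?thesis"
  then have neq: "thue_morse i \<noteq> thue_morse (i + 1)" "thue_morse (i + 1) \<noteq> thue_morse (i + 2)"
     "thue_morse (i + 2) \<noteq> thue_morse (i + 3)" "thue_morse (i + 3) \<noteq> thue_morse (i + 4)"
    by (force simp: numeral_eq_Suc)+
  then have eq: "thue_morse i = thue_morse (i + 2)" "thue_morse (i + 2) = thue_morse (i + 4)"
    using thue_morse_less[of i] thue_morse_less[of "i + 1"] thue_morse_less[of "i + 2"]
      thue_morse_less[of "i + 3"] thue_morse_less[of "i + 4"] by linarith+
  show False
  proof (cases "even i")
    case True
    then obtain j where "i = 2 * j" by (elim evenE)
    then show False
      using eq thue_morse_no_cube[of j] thue_morse_double[of j] thue_morse_double[of "Suc j"]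
        thue_morse_double[of "Suc (Suc j)"] by (simp add: eval_nat_numeral)
  next
    case False
    then obtain j where "i = 2 * j + 1" by (elim oddE)
    then show False
      using eq thue_morse_no_cube[of j] thue_morse_eq_iff_double(1)[of j "Suc j"]
        thue_morse_eq_iff_double(1)[of "Suc j" "Suc (Suc j)"] by (simp add: eval_nat_numeral)
  qed
qed

text \<open>Descent on the period: an even period can be halved, and an odd one forces three equal
  consecutive letters.\<close>

lemma thue_morse_not_ultimately_periodic:
  assumes "n > 0"
  shows "\<exists>j\<ge>i. thue_morse j \<noteq> thue_morse (j + n)"
  using assms
proof (induction n rule: less_induct)
  case (less n)
  show ?case
  proof (rule ccontr)
    assume "\<not> ?case"
    then have per: "thue_morse (j + n) = thue_morse j" if "j \<ge> i" for j
      using that by metis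
    show False
    proof (cases "even n")
      case True
      then obtain m where m: "n = 2 * m" by (elim evenE)
      then have "m < n" "m > 0" using less.prems by auto
      then obtain j where j: "j \<ge> i" "thue_morse j \<noteq> thue_morse (j + m)"
        using less.IH by blast
      have "thue_morse (2 * (j + m)) = thue_morse (2 * j)"
        using per[of "2 * j"] j(1) m by simp
      then show False using j(2) unfolding thue_morse_double by simp
    next
      case False
      then obtain m where m: "n = 2 * m + 1" by (elim oddE)
      \<comment> \<open>The odd period carries block \<open>j\<close> across a block boundary: it
        equates the second letter of block \<open>j + m\<close> with the first of block
        \<open>j\<close>, and the first of block \<open>Suc (j + m)\<close> with the second of block
        \<open>j\<close>. Both letters of the word in question are thus the complement of
        \<open>thue_morse j\<close>.\<close>
      have const: "thue_morse (j + m) = thue_morse (Suc (j + m))" if "j \<ge> i" for j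
      proof -
        have "thue_morse (Suc (2 * (j + m))) = thue_morse (2 * j)"
          using per[of "2 * j"] that m by simp
        moreover have "thue_morse (2 * Suc (j + m)) = thue_morse (Suc (2 * j))"
          using per[of "Suc (2 * j)"] that m by simp
        ultimately show ?thesis
          unfolding thue_morse_eq_iff_double
          using thue_morse_less[of j] thue_morse_less[of "j + m"] thue_morse_less[of "Suc (j + m)"]
          by linarith
      qed
      show False
        using const[of i] const[of "Suc i"] thue_morse_no_cube[of "i + m"] by simp
    qed
  qed
qed

section \<open>Factors and their desubstitution\<close>

definition tm_factor :: "nat \<Rightarrow> nat \<Rightarrow> nat list" where
  "tm_factor i n = map thue_morse [i..<i + n]"

lemma length_tm_factor [simp]: "length (tm_factor i n) = n"
  by (simp add: tm_factor_def)

lemma nth_tm_factor [simp]: "k < n \<Longrightarrow> tm_factor i n ! k = thue_morse (i + k)"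
  by (simp add: tm_factor_def)

lemma tm_factors_eq_range: "tm_factors n = range (\<lambda>i. tm_factor i n)"
  by (auto simp: tm_factors_def tm_factor_def)

lemma tm_factor_eq_iff:
  "tm_factor i n = tm_factor j n \<longleftrightarrow> (\<forall>k<n. thue_morse (i + k) = thue_morse (j + k))"
  by (auto simp: list_eq_iff_nth_eq)

text \<open>The values \<open>False\<close> and \<open>True\<close> of \<open>s\<close> give the
  sets counted by d(n) and e(n). A Boolean parameter treats both at once, since odd lengths exchange
  them under desubstitution.\<close>

definition tm_bordered :: "bool \<Rightarrow> nat \<Rightarrow> nat list set" where
  "tm_bordered s n = {tm_factor i (Suc n) |i. (thue_morse i = thue_morse (i + n)) = s}"

lemma finite_tm_bordered: "finite (tm_bordered s n)"
  by (rule finite_subset[OF _ finite_tm_factors[of "Suc n"]])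
    (auto simp: tm_bordered_def tm_factors_eq_range)

definition tm_morphism :: "nat list \<Rightarrow> nat list" where
  "tm_morphism w = concat (map (\<lambda>a. [a, 1 - a]) w)"

lemma tm_morphism_factor: "tm_morphism (tm_factor i n) = tm_factor (2 * i) (2 * n)"
proof (induction n)
  case 0
  then show ?case by (simp add: tm_morphism_def tm_factor_def)
next
  case (Suc n)
  have "tm_morphism (tm_factor i (Suc n))
      = tm_morphism (tm_factor i n) @ [thue_morse (i + n), 1 - thue_morse (i + n)]"
    by (simp add: tm_morphism_def tm_factor_def)
  also have "\<dots> = tm_factor (2 * i) (2 * n) @ [thue_morse (2 * (i + n)), thue_morse (Suc (2 * (i + n)))]"
    by (simp only: Suc thue_morse_double thue_morse_Suc_double)
  also have "\<dots> = tm_factor (2 * i) (2 * Suc n)"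
    by (simp add: tm_factor_def)
  finally show ?case .
qed

lemma butlast_tm_factor: "butlast (tm_factor i (Suc n)) = tm_factor i n"
  by (simp add: tm_factor_def)

lemma tl_tm_factor: "tl (tm_factor i (Suc n)) = tm_factor (Suc i) n"
  by (simp add: tm_factor_def upt_conv_Cons del: upt_Suc)

text \<open>These equations make the long factor a function of the short word alone, independent of
  where it occurs, so that factors can be counted through images.\<close>

lemma tm_factor_double:
  "tm_factor (2 * i) (Suc (2 * n)) = butlast (tm_morphism (tm_factor i (Suc n)))"
  "tm_factor (Suc (2 * i)) (Suc (2 * n)) = tl (tm_morphism (tm_factor i (Suc n)))"
  "tm_factor (Suc (2 * i)) (2 * n) = butlast (tl (tm_morphism (tm_factor i (Suc n))))"
  by (simp_all add: tm_morphism_factor butlast_tm_factor tl_tm_factor)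

text \<open>The end positions \<open>i\<close> and \<open>i + 2 * m\<close> have the same parity, so
  halving either keeps or complements both letters, and \<open>s\<close> is preserved. The parity of
  \<open>i\<close> selects the image.\<close>

lemma tm_bordered_double:
  "tm_bordered s (2 * m) = (\<lambda>w. butlast (tm_morphism w)) ` tm_bordered s m
    \<union> (\<lambda>w. tl (tm_morphism w)) ` tm_bordered s m" (is "?L = ?R")
proof (rule antisym)
  show "?L \<subseteq> ?R"
  proof
    fix w assume "w \<in> ?L"
    then obtain i where w: "w = tm_factor i (Suc (2 * m))"
      and i: "(thue_morse i = thue_morse (i + 2 * m)) = s"
      unfolding tm_bordered_def by blast
    show "w \<in> ?R"
    proof (cases "even i")
      case True
      then obtain j where j: "i = 2 * j" by (elim evenE)
      have "tm_factor j (Suc m) \<in> tm_bordered s m"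
        using i j thue_morse_double[of j] thue_morse_double[of "j + m"]
        by (auto simp: tm_bordered_def)
      then show ?thesis using w j tm_factor_double(1)[of j m] by blast
    next
      case False
      then obtain j where j: "i = Suc (2 * j)" by (auto elim: oddE)
      have "tm_factor j (Suc m) \<in> tm_bordered s m"
        using i j thue_morse_eq_iff_double(1)[of j "j + m"]
        by (auto simp: tm_bordered_def)
      then show ?thesis using w j tm_factor_double(2)[of j m] by blast
    qed
  qed
  show "?R \<subseteq> ?L"
  proof -
    have "tm_factor (2 * i) (Suc (2 * m)) \<in> ?L \<and> tm_factor (Suc (2 * i)) (Suc (2 * m)) \<in> ?L"
      if "(thue_morse i = thue_morse (i + m)) = s" for i
    proof -
      have "(thue_morse (2 * i) = thue_morse (2 * i + 2 * m)) = s"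
        using that thue_morse_double[of i] thue_morse_double[of "i + m"] by simp
      moreover have "(thue_morse (Suc (2 * i)) = thue_morse (Suc (2 * i) + 2 * m)) = s"
        using that thue_morse_eq_iff_double(1)[of i "i + m"] by simp
      ultimately show ?thesis unfolding tm_bordered_def by blast
    qed
    then show ?thesis
      unfolding tm_factor_double by (auto simp: tm_bordered_def[of s m])
  qed
qed

text \<open>The end positions now have opposite parity, so exactly one letter is complemented and
  \<open>s\<close> is negated. An even start covers \<open>m + 1\<close> whole blocks; an odd start
  cuts through both the first and the last of \<open>m + 2\<close> blocks.\<close>

lemma tm_bordered_Suc_double:
  "tm_bordered s (Suc (2 * m)) \<subseteq> tm_morphism ` tm_bordered (\<not> s) m
    \<union> (\<lambda>w. butlast (tl (tm_morphism w))) ` tm_bordered (\<not> s) (Suc m)" (is "?L \<subseteq> ?R")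
proof
  fix w assume "w \<in> ?L"
  then obtain i where w: "w = tm_factor i (2 * Suc m)"
    and i: "(thue_morse i = thue_morse (i + Suc (2 * m))) = s"
    unfolding tm_bordered_def by auto
  show "w \<in> ?R"
  proof (cases "even i")
    case True
    then obtain j where j: "i = 2 * j" by (elim evenE)
    have "tm_factor j (Suc m) \<in> tm_bordered (\<not> s) m"
      using i j thue_morse_eq_iff_double(2)[of j "j + m"]
      by (auto simp: tm_bordered_def)
    then show ?thesis using w j tm_morphism_factor[of j "Suc m"] by (metis UnI1 imageI)
  next
    case False
    then obtain j where j: "i = Suc (2 * j)" by (auto elim: oddE)
    have "tm_factor j (Suc (Suc m)) \<in> tm_bordered (\<not> s) (Suc m)"
      using i j thue_morse_eq_iff_double(3)[of j "Suc (j + m)"]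
      by (auto simp: tm_bordered_def)
    then show ?thesis using w j tm_factor_double(3)[of j "Suc m"] by blast
  qed
qed

section \<open>Linear bound for d(n) and e(n)\<close>

lemma card_tm_bordered_le: "n > 0 \<Longrightarrow> card (tm_bordered s n) \<le> 2 * n"
proof (induction n arbitrary: s rule: less_induct)
  case (less n)
  have union: "card (f ` A \<union> g ` B) \<le> card A + card B"
    if "finite A" "finite B" for f g :: "nat list \<Rightarrow> nat list" and A B
    using that by (meson add_mono card_Un_le card_image_le le_trans)
  \<comment> \<open>The case \<open>n = 1\<close> is counted directly: with \<open>m = 0\<close> the
    odd recursion would refer to 0 and to 1 itself.\<close>
  consider "n = 1" | m where "n = 2 * m" "m > 0" | m where "n = Suc (2 * m)" "m > 0"
  proof -
    have "n = 1 \<or> (\<exists>m>0. n = 2 * m) \<or> (\<exists>m>0. n = Suc (2 * m))"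
      using less.prems by presburger
    then show thesis using that by blast
  qed
  then show ?case
  proof cases
    case 1
    have "tm_bordered s n \<subseteq> (if s then {[0, 0], [1, 1]} else {[0, 1], [1, 0]})"
    proof
      fix w assume "w \<in> tm_bordered s n"
      then obtain i where "w = [thue_morse i, thue_morse (Suc i)]"
          "(thue_morse i = thue_morse (Suc i)) = s"
        using 1 by (auto simp: tm_bordered_def tm_factor_def)
      then show "w \<in> (if s then {[0, 0], [1, 1]} else {[0, 1], [1, 0]})"
        using thue_morse_less[of i] thue_morse_less[of "Suc i"] by (auto simp: less_2_cases_iff)
    qed
    then have "card (tm_bordered s n) \<le> card (if s then {[0, 0], [1, 1]} else {[0, 1], [1, 0 :: nat]})"
      by (intro card_mono) auto
    then show ?thesis using 1 by (auto split: if_splits)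
  next
    case (2 m)
    have "card (tm_bordered s n) \<le> card (tm_bordered s m) + card (tm_bordered s m)"
      unfolding 2 tm_bordered_double by (rule union) (rule finite_tm_bordered)+
    then show ?thesis using less.IH[of m s] 2 by simp
  next
    case (3 m)
    have "card (tm_bordered s n) \<le> card (tm_bordered (\<not> s) m) + card (tm_bordered (\<not> s) (Suc m))"
      unfolding 3
      by (rule le_trans[OF card_mono[OF _ tm_bordered_Suc_double] union])
        (auto simp: finite_tm_bordered)
    then show ?thesis using less.IH[of m "\<not> s"] less.IH[of "Suc m" "\<not> s"] 3 by simp
  qed
qed

section \<open>Cyclic classes and the upper bound\<close>

lemma cyc_equiv_iff_rotate:
  "(x, y) \<in> cyc_equiv \<longleftrightarrow> (\<exists>s. y = rotate s x)"
proof
  assume "(x, y) \<in> cyc_equiv"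
  then show "\<exists>s. y = rotate s x"
    unfolding cyc_equiv_def by (auto intro: rotate_append[symmetric])
next
  assume "\<exists>s. y = rotate s x"
  then obtain s where "y = drop (s mod length x) x @ take (s mod length x) x"
    by (auto simp: rotate_drop_take)
  moreover have "x = take (s mod length x) x @ drop (s mod length x) x" by simp
  ultimately show "(x, y) \<in> cyc_equiv"
    unfolding cyc_equiv_def by blast
qed

lemma cyc_complexity_eq: "cyc_complexity n = card ((\<lambda>w. cyc_equiv `` {w}) ` tm_factors n)"
proof -
  have "{C \<in> UNIV // cyc_equiv. \<exists>w \<in> tm_factors n. w \<in> C} = (\<lambda>w. cyc_equiv `` {w}) ` tm_factors n"
  proof (rule set_eqI)
    fix C :: "nat list set"
    show "C \<in> {C \<in> UNIV // cyc_equiv. \<exists>w \<in> tm_factors n. w \<in> C}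
      \<longleftrightarrow> C \<in> (\<lambda>w. cyc_equiv `` {w}) ` tm_factors n"
      using equiv_class_self[OF equiv_cyc_equiv] equiv_class_eq[OF equiv_cyc_equiv]
      unfolding quotient_def by blast
  qed
  then show ?thesis by (simp add: cyc_complexity_def)
qed

lemma cyc_equiv_step:
  assumes "thue_morse i = thue_morse (i + n)"
  shows "(tm_factor i n, tm_factor (Suc i) n) \<in> cyc_equiv"
proof (cases n)
  case 0
  then show ?thesis by (auto simp: tm_factor_def cyc_equiv_def)
next
  case (Suc m)
  have "tm_factor i n = [thue_morse i] @ map thue_morse [Suc i..<i + n]"
    using Suc by (simp add: tm_factor_def upt_conv_Cons del: upt_Suc)
  moreover have "tm_factor (Suc i) n = map thue_morse [Suc i..<i + n] @ [thue_morse i]"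
    using Suc assms by (simp add: tm_factor_def)
  ultimately show ?thesis unfolding cyc_equiv_def by blast
qed

lemma cyc_complexity_le: 
  assumes "n > 0"
  shows "cyc_complexity n \<le> card (tm_bordered False n)"
proof -
  have "(\<lambda>w. cyc_equiv `` {w}) ` tm_factors n
      \<subseteq> (\<lambda>w. cyc_equiv `` {butlast w}) ` tm_bordered False n"
  proof
    fix C assume "C \<in> (\<lambda>w. cyc_equiv `` {w}) ` tm_factors n"
    then obtain i where C: "C = cyc_equiv `` {tm_factor i n}"
      by (auto simp: tm_factors_eq_range)
    let ?P = "\<lambda>k. thue_morse (i + k) \<noteq> thue_morse (i + k + n)"
    \<comment> \<open>The first shift at which the leaving and the entering letter differ. All
      earlier shifts are rotations, so the window at \<open>i + k\<close> still lies in the class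
      \<open>C\<close>.\<close>
    define k where "k = (LEAST k. ?P k)"
    obtain j where "j \<ge> i" "thue_morse j \<noteq> thue_morse (j + n)"
      using thue_morse_not_ultimately_periodic[OF assms] by blast
    then have "?P (j - i)" by simp
    then have k: "?P k" unfolding k_def by (rule LeastI)
    have "cyc_equiv `` {tm_factor (i + l) n} = C" if "l \<le> k" for l
      using that
    proof (induction l)
      case 0
      then show ?case by (simp add: C)
    next
      case (Suc l)
      then have "\<not> ?P l" using not_less_Least[of l ?P] by (auto simp: k_def)
      then have "(tm_factor (i + l) n, tm_factor (i + Suc l) n) \<in> cyc_equiv"
        using cyc_equiv_step[of "i + l" n] by simp
      from equiv_class_eq[OF equiv_cyc_equiv this] show ?case using Suc by simp
    qed
    then have "C = cyc_equiv `` {butlast (tm_factor (i + k) (Suc n))}"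
      by (simp add: butlast_tm_factor)
    moreover have "tm_factor (i + k) (Suc n) \<in> tm_bordered False n"
      using k by (auto simp: tm_bordered_def)
    ultimately show "C \<in> (\<lambda>w. cyc_equiv `` {butlast w}) ` tm_bordered False n" by blast
  qed
  then show ?thesis
    unfolding cyc_complexity_eq by (rule surj_card_le[OF finite_tm_bordered])
qed

section \<open>Growth of d(n) along powers of two\<close>

text \<open>Each image determines its preimage through the letters at positions of one parity. The
  images are disjoint because an equal adjacent pair always starts at an odd position and so reveals
  the parity of the start; \<open>m \<ge> 2\<close> gives the five letters among which such a pair
  exists.\<close>

lemma card_tm_bordered_double_ge:
  assumes "m \<ge> 2"
  shows "2 * card (tm_bordered s m) \<le> card (tm_bordered s (2 * m))"
proof -
  let ?f = "\<lambda>w. butlast (tm_morphism w)" and ?g = "\<lambda>w. tl (tm_morphism w)"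
  have inj_f: "inj_on ?f (tm_bordered s m)"
  proof (rule inj_onI)
    fix x y assume "x \<in> tm_bordered s m" "y \<in> tm_bordered s m" and eq: "?f x = ?f y"
    then obtain i j where ij: "x = tm_factor i (Suc m)" "y = tm_factor j (Suc m)"
      by (auto simp: tm_bordered_def)
    have "thue_morse (2 * (i + k)) = thue_morse (2 * (j + k))" if "k \<le> m" for k
      using eq that unfolding ij tm_factor_double[symmetric] tm_factor_eq_iff
      by (auto dest: spec[of _ "2 * k"])
    then show "x = y"
      by (simp add: ij tm_factor_eq_iff thue_morse_double del: distrib_left_numeral)
  qed
  have inj_g: "inj_on ?g (tm_bordered s m)"
  proof (rule inj_onI)
    fix x y assume "x \<in> tm_bordered s m" "y \<in> tm_bordered s m" and eq: "?g x = ?g y"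
    then obtain i j where ij: "x = tm_factor i (Suc m)" "y = tm_factor j (Suc m)"
      by (auto simp: tm_bordered_def)
    have "thue_morse (Suc (2 * (i + k))) = thue_morse (Suc (2 * (j + k)))" if "k \<le> m" for k
      using eq that unfolding ij tm_factor_double[symmetric] tm_factor_eq_iff
      by (auto dest: spec[of _ "2 * k"])
    then show "x = y"
      by (simp add: ij tm_factor_eq_iff thue_morse_eq_iff_double del: distrib_left_numeral)
  qed
  have "?f ` tm_bordered s m \<inter> ?g ` tm_bordered s m = {}"
  proof (rule ccontr)
    assume "\<not> ?thesis"
    then obtain i j where "?f (tm_factor i (Suc m)) = ?g (tm_factor j (Suc m))"
      by (auto simp: tm_bordered_def)
    then have eq: "thue_morse (2 * i + k) = thue_morse (Suc (2 * j) + k)" if "k \<le> 2 * m" for k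
      using that unfolding tm_factor_double[symmetric] tm_factor_eq_iff by auto
    obtain q where q: "q < 4" "thue_morse (2 * i + q) = thue_morse (Suc (2 * i + q))"
      using thue_morse_not_alternating by blast
    have "thue_morse (Suc (2 * j) + q) = thue_morse (Suc (Suc (2 * j) + q))"
      using eq[of q] eq[of "Suc q"] q assms by simp
    then show False
      using q(2) thue_morse_Suc_neq[of "2 * i + q"] thue_morse_Suc_neq[of "Suc (2 * j) + q"]
      by (cases "even q") auto
  qed
  then have "card (tm_bordered s (2 * m)) = card (tm_bordered s m) + card (tm_bordered s m)"
    unfolding tm_bordered_double
    by (subst card_Un_disjoint) (simp_all add: finite_tm_bordered card_image[OF inj_f] card_image[OF inj_g])
  then show ?thesis by simp
qed

text \<open>The starting value at the least length to which doubling applies, with witnesses at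
  positions 0, 1, 4 and 5.\<close>

lemma card_tm_bordered_2: "4 \<le> card (tm_bordered False 2)"
proof -
  have *: "thue_morse 0 = 0" "thue_morse 1 = 1" "thue_morse 2 = 1" "thue_morse 3 = 0"
    "thue_morse 4 = 1" "thue_morse 5 = 0" "thue_morse 6 = 0" "thue_morse 7 = 1"
    using thue_morse_double[of 1] thue_morse_double[of 2] thue_morse_double[of 3]
      thue_morse_Suc_double[of 0] thue_morse_Suc_double[of 1] thue_morse_Suc_double[of 2]
      thue_morse_Suc_double[of 3] by (simp_all add: thue_morse_0)
  have "tm_factor i 3 = [thue_morse i, thue_morse (i + 1), thue_morse (i + 2)]" for i
    by (simp add: tm_factor_def numeral_3_eq_3 numeral_2_eq_2)
  then have "{tm_factor 0 3, tm_factor 1 3, tm_factor 4 3, tm_factor 5 3}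
      = {[0, 1, 1], [1, 1, 0], [1, 0, 0], [0, 0, 1]}"
    using * by (simp add: numeral_3_eq_3[symmetric] numeral_2_eq_2[symmetric])
  moreover have "{tm_factor 0 3, tm_factor 1 3, tm_factor 4 3, tm_factor 5 3}
      \<subseteq> tm_bordered False 2"
    using * by (auto simp: tm_bordered_def numeral_3_eq_3[symmetric] simp flip: One_nat_def)
  ultimately have "card {[0, 1, 1], [1, 1, 0], [1, 0, 0], [0, 0, 1 :: nat]} \<le> card (tm_bordered False 2)"
    by (metis card_mono finite_tm_bordered)
  then show ?thesis by simp
qed

lemma card_tm_bordered_power_ge: "2 ^ (k + 2) \<le> card (tm_bordered False (2 ^ (k + 1)))"
proof (induction k)
  case 0
  then show ?case using card_tm_bordered_2 by simp
next
  case (Suc k)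
  have "(2 :: nat) \<le> 2 ^ (k + 1)" by simp
  from card_tm_bordered_double_ge[OF this, of False] Suc show ?case by simp
qed

section \<open>Rotations between factors of even length\<close>

text \<open>Indices are reduced modulo \<open>N\<close> so that a rotation by \<open>s\<close> acts
  as the translation of \<open>k\<close> by \<open>s\<close>. The parity of the indices where this
  holds constrains \<open>s\<close>.\<close>

definition cyc_letters_eq :: "nat \<Rightarrow> nat \<Rightarrow> nat \<Rightarrow> bool" where
  "cyc_letters_eq i N k \<longleftrightarrow> thue_morse (i + k mod N) = thue_morse (i + Suc k mod N)"

text \<open>Reduction modulo an even \<open>N\<close> keeps the parity of the position, so a pair
  that does not wrap around is a block \<open>[a, 1 - a]\<close>.\<close>

lemma not_cyc_letters_eq:
  assumes "even N" "even (i + k)" "Suc k mod N \<noteq> 0"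
  shows "\<not> cyc_letters_eq i N k"
proof -
  have "Suc k mod N = Suc (k mod N)"
    using assms(3) by (auto simp: mod_Suc)
  moreover have "even (i + k mod N)"
    using assms(1,2) by (simp add: dvd_mod_iff)
  ultimately show ?thesis
    using thue_morse_Suc_neq[of "i + k mod N"] by (auto simp: cyc_letters_eq_def)
qed

lemma not_cyc_letters_eq_even:
  assumes "even N" "even i" "even k"
  shows "\<not> cyc_letters_eq i N k"
proof -
  have "Suc k mod N \<noteq> 0"
    using assms by (metis dvd_trans even_Suc mod_eq_0_iff_dvd)
  then show ?thesis using not_cyc_letters_eq assms by simp
qed

lemma cyc_letters_eq_exists:
  assumes "q0 + 4 < N"
  shows "\<exists>q\<ge>q0. q < q0 + 4 \<and> cyc_letters_eq i N q"
proof -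
  obtain q where "q < 4" "thue_morse (i + q0 + q) = thue_morse (Suc (i + q0 + q))"
    using thue_morse_not_alternating by blast
  then show ?thesis
    using assms by (intro exI[of _ "q0 + q"]) (simp add: cyc_letters_eq_def add_ac)
qed

lemma tm_factor_rotateD:
  assumes "tm_factor j N = rotate s (tm_factor i N)" "N > 0"
  shows "thue_morse (j + k mod N) = thue_morse (i + (k + s) mod N)"
proof -
  have "tm_factor j N ! (k mod N) = tm_factor i N ! ((s + k mod N) mod N)"
    using assms by (simp add: nth_rotate)
  then show ?thesis using assms(2) by (simp add: mod_add_right_eq add.commute)
qed

lemma cyc_letters_eq_rotate:
  assumes "tm_factor j N = rotate s (tm_factor i N)" "N > 0"
  shows "cyc_letters_eq j N k \<longleftrightarrow> cyc_letters_eq i N (k + s)"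
  using tm_factor_rotateD[OF assms, of k] tm_factor_rotateD[OF assms, of "Suc k"]
  by (simp add: cyc_letters_eq_def)

text \<open>Equal adjacent pairs have odd indices in both windows, so the rotation amount is even.
  Half of it rotates the preimages.\<close>

lemma cyc_equiv_tm_morphismD:
  assumes "m \<ge> 3" and "(tm_factor (2 * i) (2 * m), tm_factor (2 * j) (2 * m)) \<in> cyc_equiv"
  shows "(tm_factor i m, tm_factor j m) \<in> cyc_equiv"
proof -
  obtain s where s: "tm_factor (2 * j) (2 * m) = rotate s (tm_factor (2 * i) (2 * m))"
    using assms(2) cyc_equiv_iff_rotate by blast
  have N: "2 * m > 0" using assms(1) by simp
  obtain q where "cyc_letters_eq (2 * j) (2 * m) q"
    using cyc_letters_eq_exists[of 0 "2 * m"] assms(1) by fastforce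
  then have "odd q" "odd (q + s)"
    using not_cyc_letters_eq_even cyc_letters_eq_rotate[OF s N, of q] by (metis dvd_triv_left)+
  then obtain r where r: "s = 2 * r" by (metis evenE even_add)
  have "thue_morse (j + k) = thue_morse (i + (r + k) mod m)" if "k < m" for k
  proof -
    have "thue_morse (2 * j + (2 * k) mod (2 * m)) = thue_morse (2 * i + (2 * k + s) mod (2 * m))"
      by (rule tm_factor_rotateD[OF s N])
    also have "(2 * k + s) mod (2 * m) = 2 * ((r + k) mod m)"
      unfolding r mult_mod_right by (simp add: algebra_simps)
    also have "(2 * k) mod (2 * m) = 2 * k" using that by simp
    finally show ?thesis
      using thue_morse_double[of "j + k"] thue_morse_double[of "i + (r + k) mod m"] by simp
  qed
  then have "tm_factor j m = rotate r (tm_factor i m)"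
    by (intro nth_equalityI) (simp_all add: nth_rotate)
  then show ?thesis using cyc_equiv_iff_rotate by blast
qed

text \<open>All equal pairs of the even window have odd indices. In the odd window the equal wrap
  pair has the odd index \<open>2 * m - 1\<close>, while equal inner pairs have even indices, so no
  single shift suits both.\<close>

lemma not_cyc_equiv_even_odd:
  assumes "m \<ge> 3" "even i" "odd j" "thue_morse j = thue_morse (j + 2 * m - 1)"
  shows "(tm_factor i (2 * m), tm_factor j (2 * m)) \<notin> cyc_equiv"
proof
  assume "(tm_factor i (2 * m), tm_factor j (2 * m)) \<in> cyc_equiv"
  then obtain s where s: "tm_factor j (2 * m) = rotate s (tm_factor i (2 * m))"
    using cyc_equiv_iff_rotate by blast
  have N: "2 * m > 0" using assms(1) by simp
  have odd: "odd (q + s)" if "cyc_letters_eq j (2 * m) q" for q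
    using that not_cyc_letters_eq_even[of "2 * m" i "q + s"] assms(2)
      cyc_letters_eq_rotate[OF s N, of q] by auto
  have "cyc_letters_eq j (2 * m) (2 * m - 1)"
    using assms N by (simp add: cyc_letters_eq_def)
  from odd[OF this] have "even s" using N by simp
  obtain q where q: "q < 4" "cyc_letters_eq j (2 * m) q"
    using cyc_letters_eq_exists[of 0 "2 * m"] assms(1) by fastforce
  have "odd q" using odd[OF q(2)] \<open>even s\<close> by simp
  then show False using q not_cyc_letters_eq[of "2 * m" j q] assms by simp
qed

text \<open>
  In a window of even length that starts at an odd position, the only cyclically adjacent letters
  at an odd position that can be equal are the last and the first one. A rotation by an even amount
  must fix this pair, and one by an odd amount would force long alternating blocks.
\<close>
lemma cyc_equiv_odd_odd:
  assumes "m \<ge> 5" "odd i" "odd j" "thue_morse j = thue_morse (j + 2 * m - 1)"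
    and "(tm_factor i (2 * m), tm_factor j (2 * m)) \<in> cyc_equiv"
  shows "tm_factor i (2 * m) = tm_factor j (2 * m)"
proof -
  obtain s where s: "tm_factor j (2 * m) = rotate s (tm_factor i (2 * m))"
    using assms(5) cyc_equiv_iff_rotate by blast
  have N: "2 * m > 0" using assms(1) by simp
  \<comment> \<open>In the window at the odd position \<open>i\<close>, an equal pair at an odd
    index can only be the wrap pair, whose index is -1 modulo \<open>2 * m\<close>.\<close>
  have dvd: "2 * m dvd Suc (q + s)" if "cyc_letters_eq j (2 * m) q" "odd (q + s)" for q
    using that not_cyc_letters_eq[of "2 * m" i "q + s"] assms(2)
      cyc_letters_eq_rotate[OF s N, of q] by auto
  have "even s"
  proof (rule ccontr)
    assume "odd s"
    have dvd': "2 * m dvd Suc (q + s)" if "cyc_letters_eq j (2 * m) q" "q < 8" for q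
    proof -
      have "even q" using that not_cyc_letters_eq[of "2 * m" j q] assms(1,3) by auto
      then show ?thesis using dvd that \<open>odd s\<close> by simp
    qed
    \<comment> \<open>Two equal inner pairs, from index ranges 0 to 3 and 4 to 7, would both land on
      the one wrap pair although they lie less than \<open>2 * m\<close> apart. The second range
      requires \<open>8 < 2 * m\<close>.\<close>
    obtain p where p: "p < 4" "cyc_letters_eq j (2 * m) p"
      using cyc_letters_eq_exists[of 0 "2 * m"] assms(1) by fastforce
    obtain q where q: "4 \<le> q" "q < 8" "cyc_letters_eq j (2 * m) q"
      using cyc_letters_eq_exists[of 4 "2 * m"] assms(1) by fastforce
    have "2 * m dvd Suc (q + s) - Suc (p + s)"
      using dvd'[of p] dvd'[of q] p q by (intro dvd_diff_nat) auto
    then have "2 * m \<le> q - p" using p q by (intro dvd_imp_le) auto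
    then show False using q assms(1) by simp
  qed
  have "cyc_letters_eq j (2 * m) (2 * m - 1)"
    using assms N by (simp add: cyc_letters_eq_def)
  from dvd[OF this] have "2 * m dvd 2 * m + s" using \<open>even s\<close> N by simp
  then have "s mod length (tm_factor i (2 * m)) = 0" by simp
  then show ?thesis using s by (metis rotate_id)
qed

section \<open>The doubling inequality for c(n)\<close>

text \<open>Family \<open>A\<close> holds the classes of windows at even positions, \<open>B\<close>
  those of windows at odd positions with equal ends. The three preceding rigidity lemmas give the
  size of \<open>A\<close>, the disjointness of the two families and the size of
  \<open>B\<close>.\<close>

lemma cyc_complexity_double_ge:
  assumes m: "m \<ge> 5"
  shows "cyc_complexity m + card (tm_bordered False m) \<le> cyc_complexity (2 * m)"
proof -
  define cls :: "nat list \<Rightarrow> nat list set" where "cls w = cyc_equiv `` {w}" for w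
  have cls_eq: "cls x = cls y \<longleftrightarrow> (x, y) \<in> cyc_equiv" for x y
    unfolding cls_def using equiv_class_eq_iff[OF equiv_cyc_equiv, of x y] by simp
  let ?g = "\<lambda>w. butlast (tl (tm_morphism w))"
  define A where "A = (\<lambda>w. cls (tm_morphism w)) ` tm_factors m"
  define B where "B = (\<lambda>w. cls (?g w)) ` tm_bordered False m"
  \<comment> \<open>The odd window ends at \<open>2 * (i + m)\<close>, where the letter is copied,
    whereas its first letter is complemented. Differing ends before doubling thus become equal
    ends.\<close>
  have defect: "thue_morse (Suc (2 * i)) = thue_morse (Suc (2 * i) + 2 * m - 1)"
    if "thue_morse i \<noteq> thue_morse (i + m)" for i
    using that thue_morse_eq_iff_double(3)[of i "i + m"] m by simp
  have fin: "finite A" "finite B"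
    by (simp_all add: A_def B_def finite_tm_factors finite_tm_bordered)
  have cA: "cyc_complexity m \<le> card A"
  proof -
    \<comment> \<open>A left inverse by choice: all members of \<open>tm_factors m\<close> whose
      images lie in one class are themselves cyclically equivalent.\<close>
    define h where "h = (\<lambda>C. cls (SOME w. w \<in> tm_factors m \<and> cls (tm_morphism w) = C))"
    have "cls w = h (cls (tm_morphism w))" if w: "w \<in> tm_factors m" for w
    proof -
      define v where "v = (SOME v. v \<in> tm_factors m \<and> cls (tm_morphism v) = cls (tm_morphism w))"
      have v: "v \<in> tm_factors m \<and> cls (tm_morphism v) = cls (tm_morphism w)"
        unfolding v_def by (rule someI[of _ w]) (use w in simp)
      obtain i j where ij: "w = tm_factor i m" "v = tm_factor j m"
        using w v unfolding tm_factors_eq_range by blast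
      have "(tm_factor (2 * i) (2 * m), tm_factor (2 * j) (2 * m)) \<in> cyc_equiv"
        using v unfolding ij cls_eq[symmetric] tm_morphism_factor by simp
      then have "cls w = cls v"
        unfolding ij cls_eq by (rule cyc_equiv_tm_morphismD[rotated]) (use m in simp)
      then show ?thesis by (simp add: h_def v_def)
    qed
    then have "cls ` tm_factors m \<subseteq> h ` A" unfolding A_def by blast
    then show ?thesis
      unfolding cyc_complexity_eq cls_def[symmetric] using fin(1) by (intro surj_card_le)
  qed
  have cB: "card B = card (tm_bordered False m)"
    unfolding B_def
  proof (rule card_image, rule inj_onI)
    fix x y assume x: "x \<in> tm_bordered False m" and y: "y \<in> tm_bordered False m"
      and eq: "cls (?g x) = cls (?g y)"
    obtain i where i: "x = tm_factor i (Suc m)" "thue_morse i \<noteq> thue_morse (i + m)"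
      using x by (auto simp: tm_bordered_def)
    obtain j where j: "y = tm_factor j (Suc m)" "thue_morse j \<noteq> thue_morse (j + m)"
      using y by (auto simp: tm_bordered_def)
    have "tm_factor (Suc (2 * i)) (2 * m) = tm_factor (Suc (2 * j)) (2 * m)"
      by (rule cyc_equiv_odd_odd[OF m _ _ defect[OF j(2)]])
        (use eq in \<open>simp_all add: cls_eq i(1) j(1) flip: tm_factor_double(3)\<close>)
    then have *: "thue_morse (Suc (2 * i) + k) = thue_morse (Suc (2 * j) + k)" if "k < 2 * m" for k
      using that by (simp add: tm_factor_eq_iff)
    \<comment> \<open>The \<open>2 * m\<close> letters determine all \<open>m + 1\<close> letters:
      the first from its complement, every later one from the first letter of its block.\<close>
    have "thue_morse (i + k) = thue_morse (j + k)" if "k \<le> m" for k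
    proof (cases k)
      case 0
      then show ?thesis using *[of 0] m thue_morse_eq_iff_double(1)[of i j] by simp
    next
      case (Suc l)
      then have "thue_morse (2 * (i + k)) = thue_morse (2 * (j + k))"
        using *[of "Suc (2 * l)"] that by simp
      then show ?thesis by (simp only: thue_morse_double)
    qed
    then show "x = y" by (simp add: i(1) j(1) tm_factor_eq_iff)
  qed
  have disj: "A \<inter> B = {}"
  proof (rule ccontr)
    assume "A \<inter> B \<noteq> {}"
    then obtain x y where x: "x \<in> tm_factors m" and y: "y \<in> tm_bordered False m"
      and eq: "cls (tm_morphism x) = cls (?g y)"
      unfolding A_def B_def by blast
    obtain i where i: "x = tm_factor i m"
      using x by (auto simp: tm_factors_eq_range)
    obtain j where j: "y = tm_factor j (Suc m)" "thue_morse j \<noteq> thue_morse (j + m)"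
      using y by (auto simp: tm_bordered_def)
    have "(tm_factor (2 * i) (2 * m), tm_factor (Suc (2 * j)) (2 * m)) \<in> cyc_equiv"
      using eq by (simp add: cls_eq i j(1) tm_morphism_factor tl_tm_factor butlast_tm_factor)
    then show False
      using not_cyc_equiv_even_odd[OF _ _ _ defect[OF j(2)], of "2 * i"] m by simp
  qed
  have "A \<union> B \<subseteq> cls ` tm_factors (2 * m)"
    unfolding A_def B_def
    by (auto simp: tm_factors_eq_range tm_bordered_def tm_morphism_factor tl_tm_factor butlast_tm_factor)
  then have "card (A \<union> B) \<le> cyc_complexity (2 * m)"
    unfolding cyc_complexity_eq cls_def[symmetric]
    by (intro card_mono) (simp add: finite_tm_factors)
  then show ?thesis using cA cB disj fin by (simp add: card_Un_disjoint)
qed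

section \<open>Powers of two and the limit superior\<close>

text \<open>With N = \<open>2 ^ (k + 3)\<close>, adding d(N) \<ge> 2N at each doubling leaves the
  deficit from 2N constant. The value 16 makes the start N = 8 trivial, and 8 is the least power of
  two that meets the bound 5 for doubling.\<close>

lemma cyc_complexity_power_ge: "2 ^ (k + 4) \<le> cyc_complexity (2 ^ (k + 3)) + 16"
proof (induction k)
  case 0
  then show ?case by simp
next
  case (Suc k)
  have "(5 :: nat) \<le> 8" by simp
  also have "8 \<le> (2 :: nat) ^ (k + 3)" by (simp add: power_add)
  finally have "cyc_complexity (2 ^ (k + 3)) + card (tm_bordered False (2 ^ (k + 3)))
      \<le> cyc_complexity (2 * 2 ^ (k + 3))"
    by (rule cyc_complexity_double_ge)
  then show ?case
    using Suc card_tm_bordered_power_ge[of "k + 2"] by (simp add: eval_nat_numeral)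
qed

theorem corollary4:
  "limsup (\<lambda>n. ereal (real (cyc_complexity n) / real n)) = 2"
proof (rule antisym)
  let ?X = "\<lambda>n. ereal (real (cyc_complexity n) / real n)"
  have "?X n \<le> 2" if "n > 0" for n
  proof -
    have "cyc_complexity n \<le> 2 * n"
      using cyc_complexity_le card_tm_bordered_le le_trans that by blast
    then have "real (cyc_complexity n) \<le> 2 * real n" by linarith
    then show ?thesis using that by (simp add: divide_le_eq)
  qed
  then show "limsup ?X \<le> 2"
    by (intro Limsup_bounded eventually_mono[OF eventually_gt_at_top[of 0]]) auto
  let ?r = "\<lambda>k. 2 ^ (k + 3) :: nat"
  \<comment> \<open>This is the deficit 16 divided by \<open>2 ^ (k + 3)\<close>.\<close>
  have "2 - 2 * (1 / 2) ^ k \<le> real (cyc_complexity (?r k)) / real (?r k)" for k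
  proof -
    have "2 ^ (k + 4) \<le> real (cyc_complexity (?r k)) + 16"
      using cyc_complexity_power_ge[of k] by (simp flip: of_nat_le_iff[where 'a = real])
    then have "(2 - 2 * (1 / 2) ^ k) * real (?r k) \<le> real (cyc_complexity (?r k))"
      by (simp add: algebra_simps power_add power_divide)
    then show ?thesis by (subst pos_le_divide_eq) simp_all
  qed
  then have "limsup (\<lambda>k. ereal (2 - 2 * (1 / 2) ^ k)) \<le> limsup (?X \<circ> ?r)"
    by (intro Limsup_mono always_eventually) simp
  moreover have "limsup (?X \<circ> ?r) \<le> limsup ?X"
    by (rule limsup_subseq_mono) (simp add: strict_mono_def)
  moreover have "limsup (\<lambda>k. ereal (2 - 2 * (1 / 2) ^ k)) = 2"
  proof -
    have "(\<lambda>k. 2 - 2 * (1 / 2 :: real) ^ k) \<longlonglongrightarrow> 2 - 2 * 0"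
      by (intro tendsto_intros LIMSEQ_power_zero) simp
    then have "(\<lambda>k. ereal (2 - 2 * (1 / 2 :: real) ^ k)) \<longlonglongrightarrow> ereal 2" by simp
    from lim_imp_Limsup[OF _ this] show ?thesis by simp
  qed
  ultimately show "2 \<le> limsup ?X" by simp
qed

end
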